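(* Let $G$ be a linear $k$-uniform hypergraph on $n$ vertices with at least one edge, where $k$ is even and $n,k\ge 2$. Let $\mathbf{x}$ be a least eigenvector of $G$. Then for $i\in V(G)$, $$x_i^k\le \frac{d_i}{d_i+(k-1)\lambda(G)^{\frac{k}{k-1}}}$$ with equality if and only if both of the following hold: for $j\in V(G)\setminus\{i\}$, $x_j^k=\dfrac{\lambda(G)^{\frac{k}{k-1}}x_i^k}{d_i^2}$ if $j\sim i$ and $x_j=0$ otherwise; and the sign of $\mathbf{x}^{e\setminus\{i\}}$ is the same for each $e\in E_i(G)$.
   Context: A $k$-uniform hypergraph $G$ has vertex set $V(G)$ and edge set $E(G)$ consisting of $k$-element subsets of $V(G)$; it is linear if every two distinct edges intersect in at most one vertex. $E_i(G)$ is the set of edges containing $i$, and $d_i=|E_i(G)|$ is the degree of $i$. For distinct vertices $i,j$, $j\sim i$ means that some edge contains both. The adjacency tensor $\mathcal{A}(G)=(a_{i_1\dots i_k})$ has order $k$ and dimension $|V(G)|$, with $a_{i_1\dots i_k}=\frac{1}{(k-1)!}$ if $\{i_1,\dots,i_k\}\in E(G)$ and $0$ otherwise. For a vector $\mathbf{x}$ indexed by $V(G)$ and $U\subseteq V(G)$, $\mathbf{x}^U=\prod_{w\in U}x_w$. A real number $\lambda$ is an H-eigenvalue of $\mathcal{A}(G)$ with H-eigenvector $\mathbf{x}$ (a nonzero real vector) if $\lambda x_u^{k-1}=\sum_{e\in E_u(G)}\mathbf{x}^{e\setminus\{u\}}$ for all $u\in V(G)$. $\lambda(G)$ denotes the least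 H-eigenvalue of $\mathcal{A}(G)$. A least eigenvector of $G$ is a real vector $\mathbf{x}$ with $\sum_{i}|x_i|^k=1$ that is an eigenvector of $\mathcal{A}(G)$ associated with $\lambda(G)$. Since $k$ is even, $\lambda(G)^{k/(k-1)}$ is read as $(\lambda(G)^k)^{1/(k-1)}=|\lambda(G)|^{k/(k-1)}$.
   Formalization: The equality characterization is stated only for vertices with d_i > 0, since at an isolated vertex equality always holds (0 = 0) while the two conditions would force x = 0; the inequality is stated for every vertex. *)

theory Defs
  imports "HOL-Analysis.Analysis" "HOL-Combinatorics.Multiset_Permutations"
begin

definition uniform_hypergraph :: "nat \<Rightarrow> 'a set \<Rightarrow> 'a set set \<Rightarrow> bool" where
  "uniform_hypergraph k V E \<longleftrightarrow> finite V \<and> (\<forall>e\<in>E. e \<subseteq> V \<and> card e = k)"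

definition linear_edges :: "'a set set \<Rightarrow> bool" where
  "linear_edges E \<longleftrightarrow> (\<forall>e\<in>E. \<forall>f\<in>E. e \<noteq> f \<longrightarrow> card (e \<inter> f) \<le> 1)"

definition edges_at :: "'a set set \<Rightarrow> 'a \<Rightarrow> 'a set set" where
  "edges_at E i = {e \<in> E. i \<in> e}"

definition degree_at :: "'a set set \<Rightarrow> 'a \<Rightarrow> nat" where
  "degree_at E i = card (edges_at E i)"

definition adjacent :: "'a set set \<Rightarrow> 'a \<Rightarrow> 'a \<Rightarrow> bool" where
  "adjacent E i j \<longleftrightarrow> i \<noteq> j \<and> (\<exists>e\<in>E. i \<in> e \<and> j \<in> e)"

definition vec_prod :: "('a \<Rightarrow> real) \<Rightarrow> 'a set \<Rightarrow> real" where
  "vec_prod x U = (\<Prod>w\<in>U. x w)"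

text \<open>Vectors indexed by \<open>V\<close> are functions on \<open>'a\<close>, of which only the values on \<open>V\<close> matter.
  The eigenvalue equations are written edge by edge; \<open>adjacency_tensor_apply\<close> below shows that the
  right-hand side is the vector obtained by contracting the adjacency tensor with \<open>x\<close>.\<close>

definition H_eigenpair ::
    "nat \<Rightarrow> 'a set \<Rightarrow> 'a set set \<Rightarrow> real \<Rightarrow> ('a \<Rightarrow> real) \<Rightarrow> bool" where
  "H_eigenpair k V E l x \<longleftrightarrow> (\<exists>v\<in>V. x v \<noteq> 0) \<and>
     (\<forall>u\<in>V. l * x u ^ (k - 1) = (\<Sum>e\<in>edges_at E u. vec_prod x (e - {u})))"

definition H_eigenvalue :: "nat \<Rightarrow> 'a set \<Rightarrow> 'a set set \<Rightarrow> real \<Rightarrow> bool" where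
  "H_eigenvalue k V E l \<longleftrightarrow> (\<exists>x. H_eigenpair k V E l x)"

definition least_H_eigenvalue :: "nat \<Rightarrow> 'a set \<Rightarrow> 'a set set \<Rightarrow> real" where
  "least_H_eigenvalue k V E = (LEAST l. H_eigenvalue k V E l)"

definition least_eigenvector ::
    "nat \<Rightarrow> 'a set \<Rightarrow> 'a set set \<Rightarrow> ('a \<Rightarrow> real) \<Rightarrow> bool" where
  "least_eigenvector k V E x \<longleftrightarrow>
     (\<Sum>i\<in>V. \<bar>x i\<bar> ^ k) = 1 \<and> H_eigenpair k V E (least_H_eigenvalue k V E) x"

text \<open>The adjacency tensor: its indices are the lists of length \<open>k\<close> over \<open>V\<close>.\<close>

definition adjacency_tensor :: "nat \<Rightarrow> 'a set set \<Rightarrow> 'a list \<Rightarrow> real" where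
  "adjacency_tensor k E is = (if set is \<in> E then 1 / fact (k - 1) else 0)"

lemma adjacency_tensor_apply:
  assumes G: "uniform_hypergraph k V E" and k: "k \<ge> 1"
  shows "(\<Sum>is | set is \<subseteq> V \<and> length is = k - 1.
            adjacency_tensor k E (u # is) * prod_list (map x is))
       = (\<Sum>e\<in>edges_at E u. vec_prod x (e - {u}))"
proof -
  let ?L = "{is. set is \<subseteq> V \<and> length is = k - 1}"
  let ?P = "\<lambda>e. permutations_of_set (e - {u})"
  let ?f = "\<lambda>is. adjacency_tensor k E (u # is) * prod_list (map x is)"
  have finV: "finite V" using G by (simp add: uniform_hypergraph_def)
  have ed: "e \<in> E \<and> u \<in> e \<and> e \<subseteq> V \<and> finite e \<and> card e = k" if "e \<in> edges_at E u" for e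
    using that G finite_subset[OF _ finV] by (auto simp: edges_at_def uniform_hypergraph_def)
  have finE: "finite (edges_at E u)"
    by (rule finite_subset[of _ "Pow V"]) (use ed finV in auto)
  have sub: "(\<Union>e\<in>edges_at E u. ?P e) \<subseteq> ?L"
  proof
    fix xs assume "xs \<in> (\<Union>e\<in>edges_at E u. ?P e)"
    then obtain e where e: "e \<in> edges_at E u" "xs \<in> ?P e" by blast
    have "length xs = card (e - {u})" using e ed length_finite_permutations_of_set by blast
    then show "xs \<in> ?L" using e ed[OF e(1)] permutations_of_setD[OF e(2)] by auto
  qed
  have zero: "?f xs = 0" if xs: "xs \<in> ?L - (\<Union>e\<in>edges_at E u. ?P e)" for xs
  proof (cases "insert u (set xs) \<in> E")
    case True
    then have e: "insert u (set xs) \<in> edges_at E u" by (simp add: edges_at_def)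
    have c: "card (insert u (set xs)) = k" using ed[OF e] by blast
    have "u \<notin> set xs"
      using c xs k card_length[of xs] by (auto simp: insert_absorb)
    moreover from this have "card (set xs) = length xs" using c xs k by auto
    ultimately have "xs \<in> ?P (insert u (set xs))"
      by (intro permutations_of_setI) (auto intro: card_distinct)
    then show ?thesis using xs e by blast
  qed (simp add: adjacency_tensor_def)
  have "sum ?f ?L = sum ?f (\<Union>e\<in>edges_at E u. ?P e)"
    by (rule sum.mono_neutral_right) (use finV sub zero in \<open>auto simp: finite_lists_length_eq\<close>)
  also have "\<dots> = (\<Sum>e\<in>edges_at E u. sum ?f (?P e))"
  proof (rule sum.UNION_disjoint[OF finE])
    show "\<forall>e\<in>edges_at E u. \<forall>f\<in>edges_at E u. e \<noteq> f \<longrightarrow> ?P e \<inter> ?P f = {}"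
    proof (intro ballI impI equals0I)
      fix e f xs assume ef: "e \<in> edges_at E u" "f \<in> edges_at E u" "e \<noteq> f" "xs \<in> ?P e \<inter> ?P f"
      then have "e - {u} = f - {u}" by (auto dest: permutations_of_setD)
      then show False using ef ed by blast
    qed
  qed simp
  also have "\<dots> = (\<Sum>e\<in>edges_at E u. vec_prod x (e - {u}))"
  proof (rule sum.cong[OF refl])
    fix e assume e: "e \<in> edges_at E u"
    have "?f xs = 1 / fact (k - 1) * vec_prod x (e - {u})" if "xs \<in> ?P e" for xs
      using permutations_of_setD[OF that] ed[OF e]
      by (auto simp: adjacency_tensor_def vec_prod_def insert_absorb
            prod.distinct_set_conv_list[symmetric])
    then have "sum ?f (?P e) = (\<Sum>xs\<in>?P e. 1 / fact (k - 1) * vec_prod x (e - {u}))"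
      by (intro sum.cong) auto
    also have "\<dots> = vec_prod x (e - {u})" using ed[OF e] by simp
    finally show "sum ?f (?P e) = vec_prod x (e - {u})" .
  qed
  finally show ?thesis .
qed

end

theory Submission
  imports Defs
begin

text \<open>
  Write \<open>p = k - 1\<close>, \<open>X = x\<^sub>i\<^sup>k\<close>, and let \<open>\<mu> \<ge> 0\<close> be the number with \<open>\<mu>\<^sup>p = \<lambda>\<^sup>k\<close>. For an edge \<open>e\<close> at
  \<open>i\<close> let \<open>P\<^sub>e\<close> be the product of the entries of \<open>x\<close> over \<open>e - {i}\<close> and \<open>t\<^sub>e\<close> the mean of their
  \<open>k\<close>-th powers. The \<open>k\<close>-th power of the eigenvalue equation at \<open>i\<close> reads
  \<open>(\<mu> X)\<^sup>p = (\<Sum> P\<^sub>e)\<^sup>k\<close>, and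

    \<open>(\<Sum> P\<^sub>e)\<^sup>k \<le> (\<Sum> \<bar>P\<^sub>e\<bar>)\<^sup>k \<le> d\<^sup>p \<Sum> \<bar>P\<^sub>e\<bar>\<^sup>k \<le> d\<^sup>p \<Sum> t\<^sub>e\<^sup>p \<le> d\<^sup>p (\<Sum> t\<^sub>e)\<^sup>p \<le> d\<^sup>p ((1 - X) / p)\<^sup>p\<close>

  by the triangle inequality, the power mean inequality (\<open>sum_power_le_card_mult\<close>), the inequality
  of arithmetic and geometric means inside each edge (\<open>prod_le_mean_power\<close>),
  \<open>sum_of_powers_le_power_of_sum\<close>, and the normalization of \<open>x\<close>. The last step uses linearity: the
  sets \<open>e - {i}\<close> are disjoint, so \<open>p \<Sum> t\<^sub>e\<close> counts every neighbour of \<open>i\<close> once. Taking \<open>p\<close>-th roots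
  gives \<open>p \<mu> X \<le> d (1 - X)\<close>, which is the claimed bound.

  In the case of equality every link of the chain is tight. The triangle inequality then gives
  equal signs; the two mean inequalities force \<open>x\<^sub>w\<^sup>k\<close> to be one and the same number for all
  neighbours \<open>w\<close>, which the tight total identifies as \<open>\<mu> X / d\<^sup>2\<close>; and the last link says that
  the other entries vanish. Conversely, if \<open>x\<close> has these entries, then the normalization
  says \<open>1 - X = p d (\<mu> X / d\<^sup>2)\<close>, which is equality in the bound.

  Passing from \<open>p \<mu> X \<le> d (1 - X)\<close> to the quotient form requires \<open>\<mu> \<noteq> 0\<close>, which matters for an
  isolated vertex, where the bound claims \<open>x\<^sub>i = 0\<close>. Hence \<open>\<lambda> < 0\<close> is proved in
  \<open>least_H_eigenvalue_neg\<close>, by identifying the least H-eigenvalue with \<open>k\<close> times the minimum of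
  \<open>\<Sum> x\<^sup>e\<close> on the unit sphere of the \<open>k\<close>-norm. For even \<open>k\<close> this minimum is negative, as flipping
  one sign in the indicator vector of an edge shows.
\<close>

section \<open>Mean inequalities with their equality cases\<close>

text \<open>
  The gap between \<open>y\<^sup>k\<close> and the tangent at \<open>m\<close> satisfies the recursion
  \<open>gap (Suc j) = y * gap j + j * m ^ (j - 1) * (y - m)\<^sup>2\<close>, which gives the sign and, through
  the square, the equality case at once.
\<close>

lemma power_ge_tangent:
  fixes y m :: real
  assumes "y \<ge> 0" "m \<ge> 0" "k \<ge> 1"
  shows "m ^ k + real k * m ^ (k - 1) * (y - m) \<le> y ^ k"
    and "k \<ge> 2 \<Longrightarrow> y ^ k = m ^ k + real k * m ^ (k - 1) * (y - m) \<Longrightarrow> y = m"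
proof -
  define gap where "gap j = y ^ j - m ^ j - real j * m ^ (j - 1) * (y - m)" for j
  have step: "gap (Suc j) = y * gap j + real j * m ^ (j - 1) * (y - m)\<^sup>2" for j
    by (cases j) (simp_all add: gap_def algebra_simps power2_eq_square)
  have nonneg: "gap j \<ge> 0" if "j \<ge> 1" for j
    using that
  proof (induction j rule: nat_induct_at_least)
    case base
    show ?case by (simp add: gap_def)
  next
    case (Suc j)
    then show ?case using assms by (simp add: step)
  qed
  show "m ^ k + real k * m ^ (k - 1) * (y - m) \<le> y ^ k"
    using nonneg[OF assms(3)] by (simp add: gap_def)
  assume k: "k \<ge> 2" and eq: "y ^ k = m ^ k + real k * m ^ (k - 1) * (y - m)"
  obtain j where j: "k = Suc j" "j \<ge> 1" using k by (cases k) auto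
  have "y * gap j + real j * m ^ (j - 1) * (y - m)\<^sup>2 = 0"
    using eq step[of j] by (simp add: gap_def j)
  moreover have "y * gap j \<ge> 0" using nonneg[OF j(2)] assms by simp
  moreover have "real j * m ^ (j - 1) * (y - m)\<^sup>2 \<ge> 0" using assms by simp
  ultimately have "real j * m ^ (j - 1) * (y - m)\<^sup>2 = 0" by linarith
  then have "y = m \<or> m = 0" using j by auto
  moreover have "y = 0" if "m = 0"
    using eq k that by (cases "k = 1") (auto simp: power_0_left)
  ultimately show "y = m" by auto
qed

text \<open>
  The power mean inequality: sum the tangent inequality at the mean \<open>m\<close>, where the linear terms
  cancel. Equality makes every single gap vanish, so that all entries equal \<open>m\<close>.
\<close>

lemma sum_power_le_card_mult:
  fixes y :: "'a \<Rightarrow> real"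
  assumes "finite A" "\<And>a. a \<in> A \<Longrightarrow> y a \<ge> 0" "k \<ge> 2"
  shows "(\<Sum>a\<in>A. y a) ^ k \<le> real (card A) ^ (k - 1) * (\<Sum>a\<in>A. y a ^ k)"
    and "(\<Sum>a\<in>A. y a) ^ k = real (card A) ^ (k - 1) * (\<Sum>a\<in>A. y a ^ k) \<Longrightarrow>
           a \<in> A \<Longrightarrow> b \<in> A \<Longrightarrow> y a = y b"
proof -
  define d where "d = real (card A)"
  define m where "m = (\<Sum>a\<in>A. y a) / d"
  define gap where "gap a = y a ^ k - (m ^ k + real k * m ^ (k - 1) * (y a - m))" for a
  have m: "m \<ge> 0" using assms by (auto simp: m_def d_def intro!: sum_nonneg divide_nonneg_nonneg)
  have gap: "gap a \<ge> 0" if "a \<in> A" for a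
    using power_ge_tangent(1)[of "y a" m k] assms m that by (simp add: gap_def)
  have key: "d ^ (k - 1) * (\<Sum>a\<in>A. y a ^ k) - (\<Sum>a\<in>A. y a) ^ k = d ^ (k - 1) * sum gap A"
    and pos: "A \<noteq> {} \<Longrightarrow> d > 0"
  proof -
    show "d ^ (k - 1) * (\<Sum>a\<in>A. y a ^ k) - (\<Sum>a\<in>A. y a) ^ k = d ^ (k - 1) * sum gap A"
    proof (cases "A = {}")
      case True
      then show ?thesis using assms by (simp add: power_0_left)
    next
      case False
      then have d: "d > 0" using assms by (simp add: d_def card_gt_0_iff)
      have s: "(\<Sum>a\<in>A. y a) = d * m" using d by (simp add: m_def)
      have "sum gap A = (\<Sum>a\<in>A. y a ^ k) - d * m ^ k - real k * m ^ (k - 1) * (\<Sum>a\<in>A. y a - m)"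
        by (simp add: gap_def sum_subtractf sum.distrib sum_distrib_left[symmetric] d_def)
      also have "(\<Sum>a\<in>A. y a - m) = 0"
        using s by (simp add: sum_subtractf d_def)
      finally have g: "sum gap A = (\<Sum>a\<in>A. y a ^ k) - d * m ^ k" by simp
      obtain j where "k = Suc j" using assms by (cases k) auto
      then show ?thesis unfolding g s
        by (simp add: algebra_simps power_mult_distrib)
    qed
    show "A \<noteq> {} \<Longrightarrow> d > 0" using assms by (simp add: d_def card_gt_0_iff)
  qed
  have "d ^ (k - 1) * sum gap A \<ge> 0" using gap by (simp add: d_def sum_nonneg)
  then show "(\<Sum>a\<in>A. y a) ^ k \<le> real (card A) ^ (k - 1) * (\<Sum>a\<in>A. y a ^ k)"
    using key by (simp add: d_def)
  assume eq: "(\<Sum>a\<in>A. y a) ^ k = real (card A) ^ (k - 1) * (\<Sum>a\<in>A. y a ^ k)"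
    and ab: "a \<in> A" "b \<in> A"
  have "d > 0" using pos ab by blast
  then have "sum gap A = 0" using key eq by (simp add: d_def)
  then have "gap c = 0" if "c \<in> A" for c
    using sum_nonneg_eq_0_iff[of A gap] gap assms that by auto
  then have "y c = m" if "c \<in> A" for c
    using power_ge_tangent(2)[of "y c" m k] assms m that by (force simp: gap_def)
  then show "y a = y b" using ab by simp
qed

text \<open>
  The inequality of arithmetic and geometric means. With the entries scaled to \<open>z\<close> of mean 1,
  multiply the inequalities \<open>z a \<le> exp (z a - 1)\<close>: the exponents sum to 0. As \<open>exp (u - 1)\<close> meets
  \<open>u\<close> only at \<open>u = 1\<close>, an entry off the mean makes the product strictly smaller.
\<close>

lemma prod_le_mean_power:
  fixes y :: "'a \<Rightarrow> real"
  assumes "finite A" "A \<noteq> {}" "\<And>a. a \<in> A \<Longrightarrow> y a \<ge> 0"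
  defines "m \<equiv> (\<Sum>a\<in>A. y a) / real (card A)"
  shows "(\<Prod>a\<in>A. y a) \<le> m ^ card A"
    and "(\<Prod>a\<in>A. y a) = m ^ card A \<Longrightarrow> a \<in> A \<Longrightarrow> y a = m"
proof -
  have c: "card A > 0" using assms by (simp add: card_gt_0_iff)
  have m: "m \<ge> 0" unfolding m_def using assms by (auto intro!: sum_nonneg divide_nonneg_nonneg)
  have "(\<Prod>a\<in>A. y a) \<le> m ^ card A \<and> ((\<Prod>a\<in>A. y a) = m ^ card A \<longrightarrow> (\<forall>a\<in>A. y a = m))"
  proof (cases "m = 0")
    case True
    then have "\<forall>a\<in>A. y a = 0"
      using assms c sum_nonneg_eq_0_iff[of A y] by (auto simp: m_def)
    then show ?thesis using True c assms by auto
  next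
    case False
    with m have m0: "m > 0" by simp
    define z where "z a = y a / m" for a
    have z0: "z a \<ge> 0" if "a \<in> A" for a using that m assms(3) by (simp add: z_def)
    have z1: "z a \<le> exp (z a - 1)" for a using exp_ge_add_one_self[of "z a - 1"] by simp
    have z2: "z a < exp (z a - 1)" if "z a \<noteq> 1" for a
      using that exp_minus_ge exp_ge_add_one_self[of "z a - 1"]
      by (smt (verit) exp_eq_one_iff exp_gt_zero ln_eq_minus_one ln_exp)
    have "(\<Sum>a\<in>A. z a) = real (card A)"
    proof -
      have "(\<Sum>a\<in>A. y a) = real (card A) * m" using c by (simp add: m_def)
      then show ?thesis using m0 by (simp add: z_def sum_divide_distrib[symmetric])
    qed
    then have e: "(\<Prod>a\<in>A. exp (z a - 1)) = 1"
      using assms by (simp add: exp_sum[symmetric] sum_subtractf)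
    have prod_y: "(\<Prod>a\<in>A. y a) = (\<Prod>a\<in>A. z a) * m ^ card A"
      using m0 by (simp add: z_def prod_dividef)
    have "(\<Prod>a\<in>A. z a) \<le> (\<Prod>a\<in>A. exp (z a - 1))"
      by (intro prod_mono) (use z0 z1 in auto)
    then have le: "(\<Prod>a\<in>A. y a) \<le> m ^ card A"
      unfolding e prod_y using m0 by (simp add: mult_left_le_one_le prod_nonneg z0)
    have "y a = m" if "a \<in> A" "(\<Prod>a\<in>A. y a) = m ^ card A" for a
    proof (rule ccontr)
      \<comment> \<open>Only the factor at \<open>a\<close> is compared strictly, since other entries may be zero.\<close>
      assume "y a \<noteq> m"
      then have za: "z a \<noteq> 1" using m0 by (simp add: z_def)
      have "(\<Prod>a\<in>A. z a) = z a * (\<Prod>b\<in>A - {a}. z b)"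
        using that assms by (simp add: prod.remove)
      also have "\<dots> \<le> z a * (\<Prod>b\<in>A - {a}. exp (z b - 1))"
        using that z0 z1 by (intro mult_left_mono prod_mono) auto
      also have "\<dots> < exp (z a - 1) * (\<Prod>b\<in>A - {a}. exp (z b - 1))"
        using z2[OF za] by (intro mult_strict_right_mono prod_pos) auto
      also have "\<dots> = (\<Prod>b\<in>A. exp (z b - 1))"
        using that assms by (simp add: prod.remove)
      finally show False using e prod_y that m0 by simp
    qed
    then show ?thesis using le by blast
  qed
  then show "(\<Prod>a\<in>A. y a) \<le> m ^ card A"
    and "(\<Prod>a\<in>A. y a) = m ^ card A \<Longrightarrow> a \<in> A \<Longrightarrow> y a = m" by auto
qed

lemma sum_of_powers_le_power_of_sum:
  fixes t :: "'a \<Rightarrow> real"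
  assumes "finite A" "\<And>a. a \<in> A \<Longrightarrow> t a \<ge> 0" "p \<ge> 1"
  shows "(\<Sum>a\<in>A. t a ^ p) \<le> (\<Sum>a\<in>A. t a) ^ p"
proof -
  obtain q where q: "p = Suc q" using assms by (cases p) auto
  have "(\<Sum>a\<in>A. t a ^ p) \<le> (\<Sum>a\<in>A. t a * (\<Sum>a\<in>A. t a) ^ q)"
    unfolding q power_Suc
    by (intro sum_mono mult_left_mono power_mono member_le_sum) (use assms in auto)
  then show ?thesis by (simp add: q sum_distrib_right)
qed

section \<open>The least H-eigenvalue as a minimum\<close>

text \<open>
  The homogeneous form of the adjacency tensor is \<open>k\<close> times this polynomial: each edge occurs
  in \<open>k!\<close> index tuples, with weight \<open>1 / (k - 1)!\<close>.
\<close>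

definition edge_form :: "'a set set \<Rightarrow> ('a \<Rightarrow> real) \<Rightarrow> real" where
  "edge_form E x = (\<Sum>e\<in>E. vec_prod x e)"

lemma uniform_hypergraph_finite:
  assumes "uniform_hypergraph k V E"
  shows "finite V" "finite E" "e \<in> E \<Longrightarrow> finite e" "e \<in> E \<Longrightarrow> e \<subseteq> V" "e \<in> E \<Longrightarrow> card e = k"
    "finite (edges_at E u)"
proof -
  show "finite V" using assms by (simp add: uniform_hypergraph_def)
  then show "finite E"
    by (rule finite_subset[rotated, OF finite_Pow_iff[THEN iffD2]])
       (use assms in \<open>auto simp: uniform_hypergraph_def\<close>)
  then show "finite (edges_at E u)" by (simp add: edges_at_def)
  show "e \<in> E \<Longrightarrow> finite e" "e \<in> E \<Longrightarrow> e \<subseteq> V" "e \<in> E \<Longrightarrow> card e = k"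
    using assms \<open>finite V\<close> by (auto simp: uniform_hypergraph_def intro: finite_subset)
qed

lemma vec_prod_remove:
  assumes "finite e" "u \<in> e"
  shows "vec_prod x e = x u * vec_prod x (e - {u})"
  using assms by (simp add: vec_prod_def prod.remove)

text \<open>
  As a function of the single entry at \<open>u\<close> the form is affine, and its slope is the right-hand
  side of the eigenvalue equation at \<open>u\<close>.
\<close>

lemma edge_form_update:
  assumes "uniform_hypergraph k V E"
  shows "edge_form E (x(u := s)) = (\<Sum>e\<in>E - edges_at E u. vec_prod x e)
           + s * (\<Sum>e\<in>edges_at E u. vec_prod x (e - {u}))"
proof -
  note G = uniform_hypergraph_finite[OF assms]
  have "edge_form E (x(u := s)) = (\<Sum>e\<in>E - edges_at E u. vec_prod (x(u := s)) e)
          + (\<Sum>e\<in>edges_at E u. vec_prod (x(u := s)) e)"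
    unfolding edge_form_def by (rule sum.subset_diff) (use G in \<open>auto simp: edges_at_def\<close>)
  also have "(\<Sum>e\<in>E - edges_at E u. vec_prod (x(u := s)) e) = (\<Sum>e\<in>E - edges_at E u. vec_prod x e)"
    by (intro sum.cong refl) (auto simp: vec_prod_def edges_at_def intro!: prod.cong)
  also have "(\<Sum>e\<in>edges_at E u. vec_prod (x(u := s)) e)
      = (\<Sum>e\<in>edges_at E u. s * vec_prod x (e - {u}))"
  proof (intro sum.cong refl)
    fix e assume "e \<in> edges_at E u"
    then have "finite e" "u \<in> e" using G by (auto simp: edges_at_def)
    then have "vec_prod (x(u := s)) e = s * vec_prod (x(u := s)) (e - {u})"
      by (simp add: vec_prod_remove)
    also have "vec_prod (x(u := s)) (e - {u}) = vec_prod x (e - {u})"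
      unfolding vec_prod_def by (rule prod.cong) auto
    finally show "vec_prod (x(u := s)) e = s * vec_prod x (e - {u})" .
  qed
  finally show ?thesis by (simp only: sum_distrib_left)
qed

text \<open>Euler's identity for a form of degree \<open>k\<close>: each edge is counted once for each of its vertices.\<close>

lemma edge_form_Euler:
  assumes "uniform_hypergraph k V E"
  shows "(\<Sum>u\<in>V. x u * (\<Sum>e\<in>edges_at E u. vec_prod x (e - {u}))) = real k * edge_form E x"
proof -
  note G = uniform_hypergraph_finite[OF assms]
  have "(\<Sum>u\<in>V. x u * (\<Sum>e\<in>edges_at E u. vec_prod x (e - {u})))
      = (\<Sum>u\<in>V. \<Sum>e\<in>{e \<in> E. u \<in> e}. vec_prod x e)"
    using G by (auto simp: sum_distrib_left edges_at_def vec_prod_remove intro!: sum.cong)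
  also have "\<dots> = (\<Sum>e\<in>E. \<Sum>u\<in>{u \<in> V. u \<in> e}. vec_prod x e)"
    by (rule sum.swap_restrict) (use G in auto)
  also have "\<dots> = (\<Sum>e\<in>E. real k * vec_prod x e)"
  proof (intro sum.cong refl)
    fix e assume e: "e \<in> E"
    then have "{u \<in> V. u \<in> e} = e" using G(4) by auto
    then show "(\<Sum>u\<in>{u \<in> V. u \<in> e}. vec_prod x e) = real k * vec_prod x e" using G e by simp
  qed
  finally show ?thesis by (simp add: edge_form_def sum_distrib_left)
qed

text \<open>Multiplying the equation at \<open>u\<close> by \<open>x u\<close> and summing turns eigenvalues into values of the form.\<close>

lemma H_eigenpair_edge_form:
  assumes "uniform_hypergraph k V E" "H_eigenpair k V E l x" "k \<ge> 1"
  shows "l * (\<Sum>u\<in>V. x u ^ k) = real k * edge_form E x"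
proof -
  obtain j where j: "k = Suc j" using assms by (cases k) auto
  have "l * (\<Sum>u\<in>V. x u ^ k) = (\<Sum>u\<in>V. x u * (l * x u ^ (k - 1)))"
    by (simp add: j sum_distrib_left mult.left_commute)
  also have "\<dots> = (\<Sum>u\<in>V. x u * (\<Sum>e\<in>edges_at E u. vec_prod x (e - {u})))"
    using assms by (simp add: H_eigenpair_def)
  finally show ?thesis using edge_form_Euler[OF assms(1)] by simp
qed

lemma edge_form_scale:
  assumes "uniform_hypergraph k V E"
  shows "edge_form E (\<lambda>v. if v \<in> V then y v / c else 0) = edge_form E y / c ^ k"
proof -
  note G = uniform_hypergraph_finite[OF assms]
  have "vec_prod (\<lambda>v. if v \<in> V then y v / c else 0) e = vec_prod y e / c ^ k" if "e \<in> E" for e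
  proof -
    have "vec_prod (\<lambda>v. if v \<in> V then y v / c else 0) e = (\<Prod>v\<in>e. y v / c)"
      unfolding vec_prod_def by (rule prod.cong) (use G(4)[OF that] in auto)
    then show ?thesis using G(5)[OF that] by (simp add: vec_prod_def prod_dividef)
  qed
  then show ?thesis by (simp add: edge_form_def sum_divide_distrib)
qed

text \<open>
  The minimum over the unit sphere of the \<open>k\<close>-norm exists by compactness. It is stated in
  homogeneous form, valid for all vectors, so that the minimizer may be perturbed without
  renormalizing.
\<close>

lemma edge_form_minimizer:
  fixes V :: "'a set"
  assumes G: "uniform_hypergraph k V E" and k: "k \<ge> 1" "even k" and V: "V \<noteq> {}"
  obtains x where "(\<Sum>v\<in>V. x v ^ k) = 1"
    and "\<And>y. edge_form E x * (\<Sum>v\<in>V. y v ^ k) \<le> edge_form E y"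
proof -
  note finV = uniform_hypergraph_finite(1)[OF G]
  \<comment> \<open>Entries outside \<open>V\<close> are pinned to 0, so that the box is compact in the product topology on
    all functions.\<close>
  define S :: "'a \<Rightarrow> real set" where "S i = (if i \<in> V then {-1..1} else {0})" for i
  define K where "K = PiE UNIV S \<inter> {x. (\<Sum>v\<in>V. x v ^ k) = 1}"
  have coord: "continuous_on X (\<lambda>x::'a \<Rightarrow> real. x v)" for v X
    by (rule continuous_on_subset[OF continuous_on_product_coordinates]) simp
  have "compactin (product_topology (\<lambda>i. euclidean) UNIV) (PiE UNIV S)"
    by (subst compactin_PiE) (auto simp: S_def)
  then have "compact (PiE UNIV S)" by (simp add: euclidean_product_topology)
  moreover have "closed {x::'a \<Rightarrow> real. (\<Sum>v\<in>V. x v ^ k) = 1}"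
    by (intro closed_Collect_eq continuous_on_sum continuous_on_power coord continuous_on_const)
  ultimately have cK: "compact K" unfolding K_def by (rule compact_Int_closed)
  obtain w where w: "w \<in> V" using V by blast
  have "(\<lambda>v. if v = w then 1 else 0) \<in> K"
    using w finV k by (auto simp: K_def S_def if_distrib[of "\<lambda>t. t ^ k"] power_0_left cong: if_cong)
  then have neK: "K \<noteq> {}" by blast
  have "continuous_on K (edge_form E)"
    unfolding edge_form_def[abs_def] vec_prod_def by (intro continuous_on_sum continuous_on_prod coord)
  then obtain x where x: "x \<in> K" and min: "\<And>y. y \<in> K \<Longrightarrow> edge_form E x \<le> edge_form E y"
    using continuous_attains_inf[OF cK neK] by blast
  have "edge_form E x * (\<Sum>v\<in>V. y v ^ k) \<le> edge_form E y" for y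
  proof -
    define N where "N = (\<Sum>v\<in>V. y v ^ k)"
    have nn: "y v ^ k \<ge> 0" for v using k by (simp add: zero_le_even_power)
    then have N0: "N \<ge> 0" by (simp add: N_def sum_nonneg)
    show ?thesis
    proof (cases "N = 0")
      case True
      then have y0: "\<And>v. v \<in> V \<Longrightarrow> y v = 0"
        using sum_nonneg_eq_0_iff[OF finV, of "\<lambda>v. y v ^ k"] nn k by (auto simp: N_def)
      have "vec_prod y e = 0" if "e \<in> E" for e
      proof -
        note e = uniform_hypergraph_finite(3-5)[OF G that]
        then obtain v where "v \<in> e" using k by fastforce
        then show ?thesis using e y0 by (auto simp: vec_prod_def)
      qed
      then show ?thesis using True by (simp add: edge_form_def N_def)
    next
      case False
      then have N: "N > 0" using N0 by simp
      define c where "c = root k N"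
      have c: "c > 0" "c ^ k = N" using N k by (auto simp: c_def)
      define z where "z = (\<lambda>v. if v \<in> V then y v / c else 0)"
      have zN: "(\<Sum>v\<in>V. z v ^ k) = 1"
        using c N by (simp add: z_def power_divide sum_divide_distrib[symmetric]) (simp add: N_def)
      have "\<bar>z v\<bar> \<le> 1" if "v \<in> V" for v
      proof -
        have "z v ^ k \<le> (\<Sum>v\<in>V. z v ^ k)"
          by (rule member_le_sum) (use that finV k in \<open>auto simp: zero_le_even_power\<close>)
        then have "\<bar>z v\<bar> ^ k \<le> 1 ^ k" using zN k by (simp add: power_even_abs)
        then show ?thesis using k by (subst (asm) power_mono_iff) auto
      qed
      then have "z v \<in> S v" for v
        by (cases "v \<in> V") (auto simp: S_def abs_le_iff minus_le_iff, simp add: z_def)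
      then have "z \<in> K" using zN by (auto simp: K_def)
      then have "edge_form E x \<le> edge_form E y / N"
        using min[of z] edge_form_scale[OF G, of y c] c by (simp add: z_def)
      then show ?thesis using N by (simp add: N_def field_simps)
    qed
  qed
  then show ?thesis using that x by (auto simp: K_def)
qed

text \<open>
  A minimizer of the form solves the eigenvalue equations by the first-order condition in each
  entry, so \<open>k\<close> times the minimum is an H-eigenvalue; no H-eigenvalue is smaller, as each is
  \<open>k\<close> times a value of the form on the sphere. In particular the least H-eigenvalue exists.
\<close>

lemma least_H_eigenvalue_neg:
  fixes V :: "'a set"
  assumes G: "uniform_hypergraph k V E" and E: "E \<noteq> {}" and k: "k \<ge> 1" "even k"
  shows "least_H_eigenvalue k V E < 0"
proof -
  note fin = uniform_hypergraph_finite[OF G]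
  obtain e where e: "e \<in> E" using E by blast
  obtain v where v: "v \<in> e" using fin(3,5)[OF e] k by fastforce
  have V: "V \<noteq> {}" using v e fin(4) by blast
  obtain x where x1: "(\<Sum>v\<in>V. x v ^ k) = 1"
    and min: "\<And>y. edge_form E x * (\<Sum>v\<in>V. y v ^ k) \<le> edge_form E y"
    using edge_form_minimizer[OF G k V] by blast
  define l where "l = real k * edge_form E x"
  have eigen: "H_eigenpair k V E l x"
    unfolding H_eigenpair_def
  proof (intro conjI ballI)
    show "\<exists>v\<in>V. x v \<noteq> 0"
    proof (rule ccontr)
      assume "\<not> (\<exists>v\<in>V. x v \<noteq> 0)"
      then have "(\<Sum>v\<in>V. x v ^ k) = 0" using k by auto
      then show False using x1 by simp
    qed
    fix u assume u: "u \<in> V"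
    define A where "A = (\<Sum>e\<in>E - edges_at E u. vec_prod x e)"
    define B where "B = (\<Sum>e\<in>edges_at E u. vec_prod x (e - {u}))"
    define C where "C = (\<Sum>v\<in>V - {u}. x v ^ k)"
    define h where "h s = A + s * B - edge_form E x * (s ^ k + C)" for s
    have C: "(\<Sum>v\<in>V. (x(u := s)) v ^ k) = s ^ k + C" for s
      using u fin(1) by (simp add: sum.remove C_def)
    have h: "h s = edge_form E (x(u := s)) - edge_form E x * (\<Sum>v\<in>V. (x(u := s)) v ^ k)" for s
      unfolding h_def C edge_form_update[OF G] A_def B_def by simp
    have h0: "h (x u) = 0" using x1 by (simp add: h)
    have hge: "h s \<ge> 0" for s using min[of "x(u := s)"] by (simp add: h)
    have "(h has_real_derivative B - edge_form E x * (real k * x u ^ (k - 1))) (at (x u))"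
      unfolding h_def by (auto intro!: derivative_eq_intros)
    then have "B - edge_form E x * (real k * x u ^ (k - 1)) = 0"
      by (rule DERIV_local_min[where d = 1]) (use h0 hge in auto)
    then show "l * x u ^ (k - 1) = (\<Sum>e\<in>edges_at E u. vec_prod x (e - {u}))"
      by (simp add: l_def B_def)
  qed
  have least: "l \<le> l'" if "H_eigenvalue k V E l'" for l'
  proof -
    obtain y where y: "H_eigenpair k V E l' y" using \<open>H_eigenvalue k V E l'\<close> by (auto simp: H_eigenvalue_def)
    then obtain v where "v \<in> V" "y v \<noteq> 0" by (auto simp: H_eigenpair_def)
    then have N: "(\<Sum>v\<in>V. y v ^ k) > 0"
      using fin(1) k by (intro sum_pos2[of V v]) (auto simp: zero_le_even_power zero_less_power_eq)
    have "l * (\<Sum>v\<in>V. y v ^ k) \<le> l' * (\<Sum>v\<in>V. y v ^ k)"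
      using H_eigenpair_edge_form[OF G y k(1)] mult_left_mono[OF min[of y], of "real k"]
      by (simp add: l_def mult.assoc)
    then show ?thesis using N by simp
  qed
  have "least_H_eigenvalue k V E = l"
    unfolding least_H_eigenvalue_def
    by (rule Least_equality) (use eigen least in \<open>auto simp: H_eigenvalue_def\<close>)
  moreover have "l < 0"
  proof -
    \<comment> \<open>A test vector supported on one edge, with exactly one negative entry: no other edge lies
      inside the support, since all edges have the same size.\<close>
    define y where "y w = (if w \<in> e then if w = v then - 1 else 1 else (0::real))" for w
    have "vec_prod y f = 0" if f: "f \<in> E - {e}" for f
    proof -
      have "\<not> f \<subseteq> e" using f e fin(3,5) card_subset_eq[of e f] by auto
      then show ?thesis using f fin(3) by (auto simp: vec_prod_def y_def)
    qed
    then have "edge_form E y = vec_prod y e"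
      using e fin(2) by (simp add: edge_form_def sum.remove)
    also have "\<dots> = - 1"
      using v fin(3)[OF e] by (simp add: vec_prod_remove) (simp add: y_def vec_prod_def)
    finally have "edge_form E x * (\<Sum>v\<in>V. y v ^ k) < 0" using min[of y] by simp
    moreover have "(\<Sum>v\<in>V. y v ^ k) \<ge> 0" using k by (simp add: sum_nonneg zero_le_even_power)
    ultimately have "edge_form E x < 0" by (auto simp: mult_less_0_iff)
    then show "l < 0" using k by (simp add: l_def mult_less_0_iff)
  qed
  ultimately show ?thesis by simp
qed

section \<open>The estimate at a vertex\<close>

text \<open>By linearity, distinct edges at \<open>i\<close> meet only in \<open>i\<close>, so each neighbour is counted once.\<close>

lemma sum_over_neighbours:
  fixes g :: "'a \<Rightarrow> real"
  assumes G: "uniform_hypergraph k V E" and lin: "linear_edges E"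
  shows "(\<Sum>e\<in>edges_at E i. \<Sum>w\<in>e - {i}. g w) = (\<Sum>w\<in>{w. adjacent E i w}. g w)"
proof -
  note fin = uniform_hypergraph_finite[OF G]
  have "{w. adjacent E i w} = (\<Union>e\<in>edges_at E i. e - {i})"
    by (auto simp: adjacent_def edges_at_def)
  moreover have "(\<Sum>w\<in>(\<Union>e\<in>edges_at E i. e - {i}). g w) = (\<Sum>e\<in>edges_at E i. \<Sum>w\<in>e - {i}. g w)"
  proof (rule sum.UNION_disjoint[OF fin(6)])
    show "\<forall>e\<in>edges_at E i. finite (e - {i})" using fin by (simp add: edges_at_def)
    show "\<forall>e\<in>edges_at E i. \<forall>f\<in>edges_at E i. e \<noteq> f \<longrightarrow> (e - {i}) \<inter> (f - {i}) = {}"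
    proof (intro ballI impI equals0I)
      fix e f w
      assume ef: "e \<in> edges_at E i" "f \<in> edges_at E i" "e \<noteq> f" and w: "w \<in> (e - {i}) \<inter> (f - {i})"
      then have "card {i, w} \<le> card (e \<inter> f)"
        using fin(3) by (intro card_mono) (auto simp: edges_at_def)
      moreover have "card (e \<inter> f) \<le> 1" using ef lin by (auto simp: linear_edges_def edges_at_def)
      ultimately show False using w by auto
    qed
  qed
  ultimately show ?thesis by simp
qed

text \<open>
  The chain of inequalities described at the beginning, in a form without quotients and real
  powers, which holds for every normalized eigenvector and also at isolated vertices. The second
  part evaluates the tightness of its links.
\<close>

lemma eigenvector_entry_estimate:
  fixes V :: "'a set"
  assumes G: "uniform_hypergraph k V E" and lin: "linear_edges E" and k: "k \<ge> 2" "even k"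
    and eigen: "H_eigenpair k V E l x" and norm: "(\<Sum>v\<in>V. x v ^ k) = 1" and i: "i \<in> V"
    and \<mu>: "\<mu> \<ge> 0" "\<mu> ^ (k - 1) = l ^ k"
  defines "d \<equiv> real (degree_at E i)"
  shows "real (k - 1) * (\<mu> * x i ^ k) \<le> d * (1 - x i ^ k)"
    and "real (k - 1) * (\<mu> * x i ^ k) = d * (1 - x i ^ k) \<Longrightarrow> d > 0 \<Longrightarrow>
      (\<forall>j\<in>V - {i}. if adjacent E i j then x j ^ k = \<mu> * x i ^ k / d\<^sup>2 else x j = 0) \<and>
      (\<forall>e\<in>edges_at E i. \<forall>f\<in>edges_at E i.
         sgn (vec_prod x (e - {i})) = sgn (vec_prod x (f - {i})))"
proof -
  note fin = uniform_hypergraph_finite[OF G]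
  let ?Ei = "edges_at E i" and ?N = "{w. adjacent E i w}"
  define p where "p = k - 1"
  define P where "P e = vec_prod x (e - {i})" for e
  define t where "t e = (\<Sum>w\<in>e - {i}. x w ^ k) / real p" for e
  define T where "T = (\<Sum>e\<in>?Ei. t e)"
  define Q where "Q = (1 - x i ^ k) / real p"
  have p: "p \<ge> 1" "k = Suc p" using k by (auto simp: p_def)
  have d: "d = real (card ?Ei)" by (simp add: d_def degree_at_def)
  have nn: "y ^ k \<ge> 0" for y :: real using k by (simp add: zero_le_even_power)
  have ed: "finite (e - {i})" "card (e - {i}) = p" "e - {i} \<noteq> {}" if "e \<in> ?Ei" for e
  proof -
    show "finite (e - {i})" and c: "card (e - {i}) = p"
      using that fin(3,5) by (auto simp: edges_at_def p_def)
    show "e - {i} \<noteq> {}" using c p by fastforce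
  qed
  have t0: "t e \<ge> 0" for e by (simp add: t_def sum_nonneg nn)
  have T0: "T \<ge> 0" by (simp add: T_def sum_nonneg t0)
  have N: "?N \<subseteq> V - {i}" using fin(4) by (auto simp: adjacent_def)
  have rest: "(\<Sum>w\<in>V - {i}. x w ^ k) = 1 - x i ^ k"
    using norm i fin(1) by (simp add: sum.remove)
  have T: "T = (\<Sum>w\<in>?N. x w ^ k) / real p"
    unfolding T_def t_def sum_divide_distrib[symmetric] sum_over_neighbours[OF G lin] ..
  have split: "(\<Sum>w\<in>V - {i}. x w ^ k) = (\<Sum>w\<in>V - {i} - ?N. x w ^ k) + (\<Sum>w\<in>?N. x w ^ k)"
    using fin(1) N by (intro sum.subset_diff) auto
  then have TQ: "T \<le> Q"
    using rest sum_nonneg[of "V - {i} - ?N" "\<lambda>w. x w ^ k"] nn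
    unfolding T Q_def by (intro divide_right_mono) auto
  have absP: "\<bar>P e\<bar> ^ k = (\<Prod>w\<in>e - {i}. x w ^ k)" for e
    using k by (simp add: P_def vec_prod_def power_even_abs prod_power_distrib)
  have Pt: "\<bar>P e\<bar> ^ k \<le> t e ^ p" if "e \<in> ?Ei" for e
    using prod_le_mean_power(1)[OF ed(1,3)[OF that], of "\<lambda>w. x w ^ k"] nn ed(2)[OF that]
    by (simp add: absP t_def)

  have c0: "(\<mu> * x i ^ k) ^ p = \<bar>\<Sum>e\<in>?Ei. P e\<bar> ^ k"
  proof -
    have "(\<mu> * x i ^ k) ^ p = (l * x i ^ p) ^ k"
      by (simp only: power_mult_distrib \<mu>(2)[folded p_def] power_mult[symmetric] mult.commute[of k p])
    also have "l * x i ^ p = (\<Sum>e\<in>?Ei. P e)"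
      using eigen i by (simp add: H_eigenpair_def p_def P_def)
    finally show ?thesis using k by (simp add: power_even_abs)
  qed
  have c1: "\<bar>\<Sum>e\<in>?Ei. P e\<bar> ^ k \<le> (\<Sum>e\<in>?Ei. \<bar>P e\<bar>) ^ k"
    by (intro power_mono) auto
  have c2: "(\<Sum>e\<in>?Ei. \<bar>P e\<bar>) ^ k \<le> d ^ p * (\<Sum>e\<in>?Ei. \<bar>P e\<bar> ^ k)"
    unfolding d p_def by (rule sum_power_le_card_mult(1)) (use fin k in auto)
  have c3: "d ^ p * (\<Sum>e\<in>?Ei. \<bar>P e\<bar> ^ k) \<le> d ^ p * (\<Sum>e\<in>?Ei. t e ^ p)"
    using Pt by (intro mult_left_mono sum_mono) (auto simp: d)
  have c4: "d ^ p * (\<Sum>e\<in>?Ei. t e ^ p) \<le> d ^ p * T ^ p"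
    unfolding T_def
    by (intro mult_left_mono sum_of_powers_le_power_of_sum) (use fin t0 p in \<open>auto simp: d\<close>)
  have c5: "d ^ p * T ^ p \<le> d ^ p * Q ^ p"
    using TQ T0 by (intro mult_left_mono power_mono) (auto simp: d)
  have "(\<mu> * x i ^ k) ^ p \<le> (d * Q) ^ p"
    using c0 c1 c2 c3 c4 c5 by (simp add: power_mult_distrib)
  moreover have "d * Q \<ge> 0" using TQ T0 by (simp add: d)
  ultimately have "\<mu> * x i ^ k \<le> d * Q"
    using \<mu>(1) nn p by (subst (asm) power_mono_iff) auto
  then show "real (k - 1) * (\<mu> * x i ^ k) \<le> d * (1 - x i ^ k)"
    using p by (simp add: Q_def field_simps)

  assume "real (k - 1) * (\<mu> * x i ^ k) = d * (1 - x i ^ k)" and d0: "d > 0"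
  then have tight: "\<mu> * x i ^ k = d * Q" using p by (simp add: Q_def field_simps)
  then have "(\<mu> * x i ^ k) ^ p = d ^ p * Q ^ p" by (simp add: power_mult_distrib)
  then have e1: "\<bar>\<Sum>e\<in>?Ei. P e\<bar> ^ k = (\<Sum>e\<in>?Ei. \<bar>P e\<bar>) ^ k"
    and e2: "(\<Sum>e\<in>?Ei. \<bar>P e\<bar>) ^ k = d ^ p * (\<Sum>e\<in>?Ei. \<bar>P e\<bar> ^ k)"
    and e3: "d ^ p * (\<Sum>e\<in>?Ei. \<bar>P e\<bar> ^ k) = d ^ p * (\<Sum>e\<in>?Ei. t e ^ p)"
    and e5: "d ^ p * T ^ p = d ^ p * Q ^ p"
    using c0 c1 c2 c3 c4 c5 by linarith+
  have absPeq: "\<bar>P e\<bar> = \<bar>P f\<bar>" if "e \<in> ?Ei" "f \<in> ?Ei" for e f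
    by (rule sum_power_le_card_mult(2)[OF fin(6)[of i] _ k(1) e2[unfolded d p_def] that]) simp
  have Pteq: "\<bar>P e\<bar> ^ k = t e ^ p" if "e \<in> ?Ei" for e
  proof -
    have "(\<Sum>e\<in>?Ei. t e ^ p - \<bar>P e\<bar> ^ k) = 0" using e3 d0 by (simp add: sum_subtractf)
    then have "\<forall>e\<in>?Ei. t e ^ p - \<bar>P e\<bar> ^ k = 0"
      using sum_nonneg_eq_0_iff[OF fin(6)[of i], of "\<lambda>e. t e ^ p - \<bar>P e\<bar> ^ k"] Pt by simp
    then show ?thesis using that by simp
  qed
  have xt: "x w ^ k = t e" if "e \<in> ?Ei" "w \<in> e - {i}" for e w
    using prod_le_mean_power(2)[OF ed(1,3)[OF that(1)], of "\<lambda>w. x w ^ k" w] nn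
      ed(2)[OF that(1)] that(2) Pteq[OF that(1)] by (simp add: absP t_def)
  have TeqQ: "T = Q"
    using e5 d0 T0 TQ p by (simp add: power_eq_iff_eq_base)
  have te: "t e = \<mu> * x i ^ k / d\<^sup>2" if "e \<in> ?Ei" for e
  proof -
    have "t f = t e" if f: "f \<in> ?Ei" for f
    proof -
      have "t f ^ p = t e ^ p" using Pteq absPeq f \<open>e \<in> ?Ei\<close> by metis
      then show ?thesis using t0 p by (simp add: power_eq_iff_eq_base)
    qed
    then have "T = d * t e" by (simp add: T_def d)
    \<comment> \<open>Together with \<open>T = Q\<close> and \<open>\<mu> X = d Q\<close> this determines the common value.\<close>
    then show ?thesis using tight TeqQ d0 by (simp add: power2_eq_square)
  qed
  have zero: "x j = 0" if "j \<in> V - {i}" "\<not> adjacent E i j" for j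
  proof -
    have "(\<Sum>w\<in>V - {i} - ?N. x w ^ k) = 0"
      using TeqQ rest split p by (simp add: T Q_def)
    then have "x j ^ k = 0"
      using sum_nonneg_eq_0_iff[of "V - {i} - ?N" "\<lambda>w. x w ^ k"] nn fin(1) that by auto
    then show ?thesis using k by simp
  qed
  have sgn: "sgn (P e) = sgn (P f)" if ef: "e \<in> ?Ei" "f \<in> ?Ei" for e f
  proof -
    have "\<bar>\<Sum>e\<in>?Ei. P e\<bar> = (\<Sum>e\<in>?Ei. \<bar>P e\<bar>)"
      using e1 k by (subst (asm) power_eq_iff_eq_base) (auto simp: sum_nonneg)
    then have "(\<Sum>e\<in>?Ei. \<bar>P e\<bar>) - (\<Sum>e\<in>?Ei. P e) = 0 \<or> (\<Sum>e\<in>?Ei. \<bar>P e\<bar>) + (\<Sum>e\<in>?Ei. P e) = 0"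
      by linarith
    then consider "(\<Sum>e\<in>?Ei. \<bar>P e\<bar> - P e) = 0" | "(\<Sum>e\<in>?Ei. \<bar>P e\<bar> + P e) = 0"
      unfolding sum_subtractf sum.distrib by blast
    then have "(\<forall>e\<in>?Ei. \<bar>P e\<bar> - P e = 0) \<or> (\<forall>e\<in>?Ei. \<bar>P e\<bar> + P e = 0)"
    proof cases
      case 1
      then show ?thesis using sum_nonneg_eq_0_iff[OF fin(6)[of i], of "\<lambda>e. \<bar>P e\<bar> - P e"] by simp
    next
      case 2
      have "\<bar>P e\<bar> + P e \<ge> 0" for e by linarith
      with 2 show ?thesis using sum_nonneg_eq_0_iff[OF fin(6)[of i], of "\<lambda>e. \<bar>P e\<bar> + P e"] by simp
    qed
    then have "P e = P f"
    proof
      assume "\<forall>e\<in>?Ei. \<bar>P e\<bar> - P e = 0"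
      then have "\<bar>P e\<bar> - P e = 0" "\<bar>P f\<bar> - P f = 0" using ef by simp_all
      then show ?thesis using absPeq[OF ef] by linarith
    next
      assume "\<forall>e\<in>?Ei. \<bar>P e\<bar> + P e = 0"
      then have "\<bar>P e\<bar> + P e = 0" "\<bar>P f\<bar> + P f = 0" using ef by simp_all
      then show ?thesis using absPeq[OF ef] by linarith
    qed
    then show ?thesis by simp
  qed
  show "(\<forall>j\<in>V - {i}. if adjacent E i j then x j ^ k = \<mu> * x i ^ k / d\<^sup>2 else x j = 0) \<and>
      (\<forall>e\<in>?Ei. \<forall>f\<in>?Ei. sgn (vec_prod x (e - {i})) = sgn (vec_prod x (f - {i})))"
  proof (intro conjI ballI)
    fix j assume j: "j \<in> V - {i}"
    have nbr: "x j ^ k = \<mu> * x i ^ k / d\<^sup>2" if "adjacent E i j"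
    proof -
      obtain e where "e \<in> ?Ei" "j \<in> e - {i}" using \<open>adjacent E i j\<close> by (auto simp: adjacent_def edges_at_def)
      then show ?thesis using xt te by metis
    qed
    show "if adjacent E i j then x j ^ k = \<mu> * x i ^ k / d\<^sup>2 else x j = 0"
      using nbr zero[OF j] by simp
  next
    fix e f assume "e \<in> ?Ei" "f \<in> ?Ei"
    then show "sgn (vec_prod x (e - {i})) = sgn (vec_prod x (f - {i}))"
      by (rule sgn[unfolded P_def])
  qed
qed

text \<open>
  For the converse direction: there are \<open>(k - 1) d\<close> neighbours, and with equal \<open>k\<close>-th powers on
  them and zeros elsewhere the normalization determines \<open>x\<^sub>i\<^sup>k\<close>.
\<close>

lemma neighbours_carry_rest:
  fixes V :: "'a set" and x :: "'a \<Rightarrow> real"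
  assumes G: "uniform_hypergraph k V E" and lin: "linear_edges E" and k: "k \<ge> 1"
    and norm: "(\<Sum>v\<in>V. x v ^ k) = 1" and i: "i \<in> V"
    and x: "\<And>j. j \<in> V - {i} \<Longrightarrow> if adjacent E i j then x j ^ k = c else x j = 0"
  shows "1 - x i ^ k = real (k - 1) * real (degree_at E i) * c"
proof -
  note fin = uniform_hypergraph_finite[OF G]
  let ?N = "{w. adjacent E i w}"
  have N: "?N \<subseteq> V - {i}" using fin(4) by (auto simp: adjacent_def)
  have "1 - x i ^ k = (\<Sum>w\<in>V - {i}. x w ^ k)"
    using norm i fin(1) by (simp add: sum.remove)
  also have "\<dots> = (\<Sum>w\<in>?N. x w ^ k)"
  proof (rule sum.mono_neutral_right)
    show "\<forall>w\<in>V - {i} - ?N. x w ^ k = 0"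
    proof
      fix w assume "w \<in> V - {i} - ?N"
      then show "x w ^ k = 0" using x[of w] k by simp
    qed
  qed (use fin(1) N in auto)
  also have "\<dots> = (\<Sum>w\<in>?N. c)"
  proof (rule sum.cong[OF refl])
    fix w assume "w \<in> ?N"
    then show "x w ^ k = c" using x[of w] N by auto
  qed
  also have "\<dots> = (\<Sum>e\<in>edges_at E i. \<Sum>w\<in>e - {i}. c)"
    by (rule sum_over_neighbours[OF G lin, symmetric])
  also have "\<dots> = (\<Sum>e\<in>edges_at E i. real (k - 1) * c)"
    using fin(3,5) by (intro sum.cong refl) (auto simp: edges_at_def)
  finally show ?thesis by (simp add: degree_at_def)
qed

theorem theorem5p3:
  fixes V :: "'a set" and E :: "'a set set" and x :: "'a \<Rightarrow> real" and i :: 'a and k n :: nat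
  assumes "uniform_hypergraph k V E" and "linear_edges E" and "E \<noteq> {}"
    and "card V = n" and "n \<ge> 2" and "k \<ge> 2" and "even k"
    and "least_eigenvector k V E x"
    and "i \<in> V"
  shows "let d = real (degree_at E i);
             \<mu> = (least_H_eigenvalue k V E ^ k) powr (1 / (real k - 1));
             bound = d / (d + (real k - 1) * \<mu>)
         in x i ^ k \<le> bound \<and>
            (d > 0 \<longrightarrow>
              (x i ^ k = bound \<longleftrightarrow>
                (\<forall>j\<in>V - {i}. if adjacent E i j then x j ^ k = \<mu> * x i ^ k / d\<^sup>2 else x j = 0) \<and>
                (\<forall>e\<in>edges_at E i. \<forall>f\<in>edges_at E i.
                   sgn (vec_prod x (e - {i})) = sgn (vec_prod x (f - {i})))))"
proof -
  define l where "l = least_H_eigenvalue k V E"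
  define d where "d = real (degree_at E i)"
  define \<mu> where "\<mu> = (l ^ k) powr (1 / (real k - 1))"
  note G = assms(1) and lin = assms(2) and k = assms(6,7) and i = assms(9)
  have rk: "real k - 1 = real (k - 1)" "real (k - 1) > 0" using k by auto
  have eigen: "H_eigenpair k V E l x" and norm: "(\<Sum>v\<in>V. x v ^ k) = 1"
    using assms(8) k by (auto simp: least_eigenvector_def l_def power_even_abs)
  have "l < 0" using least_H_eigenvalue_neg[OF G assms(3)] k by (simp add: l_def)
  then have "l ^ k > 0" using k by (simp add: zero_less_power_eq)
  then have \<mu>0: "\<mu> > 0" using \<open>l < 0\<close> by (simp add: \<mu>_def)
  have \<mu>: "\<mu> ^ (k - 1) = l ^ k"
  proof -
    have "\<mu> ^ (k - 1) = \<mu> powr real (k - 1)" by (rule powr_realpow[OF \<mu>0, symmetric])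
    also have "\<dots> = (l ^ k) powr 1"
      unfolding \<mu>_def powr_powr rk(1) using rk(2) by simp
    finally show ?thesis using \<open>l ^ k > 0\<close> by (simp only: powr_one)
  qed
  note est = eigenvector_entry_estimate[OF G lin k eigen norm i less_imp_le[OF \<mu>0] \<mu>, folded d_def]
  have "d \<ge> 0" by (simp add: d_def)
  then have den: "d + (real k - 1) * \<mu> > 0" using \<mu>0 rk by (simp add: add_nonneg_pos)
  have le: "x i ^ k \<le> d / (d + (real k - 1) * \<mu>)"
    using est(1) den unfolding rk(1) by (simp add: pos_le_divide_eq algebra_simps)
  have eq: "x i ^ k = d / (d + (real k - 1) * \<mu>)
      \<longleftrightarrow> real (k - 1) * (\<mu> * x i ^ k) = d * (1 - x i ^ k)"
    using den unfolding rk(1) by (auto simp: eq_divide_eq algebra_simps)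
  have conv: "real (k - 1) * (\<mu> * x i ^ k) = d * (1 - x i ^ k)"
    if "d > 0" "\<forall>j\<in>V - {i}. if adjacent E i j then x j ^ k = \<mu> * x i ^ k / d\<^sup>2 else x j = 0"
  proof -
    have "1 - x i ^ k = real (k - 1) * d * (\<mu> * x i ^ k / d\<^sup>2)"
      unfolding d_def
      by (rule neighbours_carry_rest[OF G lin _ norm i]) (use k that in \<open>auto simp: d_def\<close>)
    then show ?thesis using \<open>d > 0\<close> by (simp add: power2_eq_square)
  qed
  show ?thesis
    unfolding Let_def l_def[symmetric] d_def[symmetric] \<mu>_def[symmetric]
    using le eq est(2) conv by blast
qed

end
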